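(* Let $\mathbb{K}$ be a field, let $V$ be a finite-dimensional $\mathbb{K}$-vector space, and let $\mathcal{A}$ be a central hyperplane arrangement in $V$. If $\mathcal{A}$ is inductively factored, then for every linear subspace $U$ of $V$ the localization $\mathcal{A}_U=\{H\in\mathcal{A}\mid U\subseteq H\}$ (an arrangement in $V$) is inductively factored.
   Context: Arrangements. A hyperplane arrangement $\mathcal{A}$ in a finite-dimensional $\mathbb{K}$-vector space $V$ is a finite collection (set) of hyperplanes in $V$. All arrangements are central, i.e. $0\in H$ for every $H\in\mathcal{A}$, so the hyperplanes are linear subspaces of codimension one. If $\dim V=\ell$, the empty arrangement in $V$ is denoted $\Phi_\ell$ (for each $\ell\ge 0$). For a linear subspace $U\subseteq V$, the localization of $\mathcal{A}$ at $U$ is $\mathcal{A}_U=\{H\in\mathcal{A}\mid U\subseteq H\}$. Triples. For $\mathcal{A}$ non-empty and $H_0\in\mathcal{A}$, the triple associated with $H_0$ is $(\mathcal{A},\mathcal{A}',\mathcal{A}'')$, where $\mathcal{A}'=\mathcal{A}\setminus\{H_0\}$ is an arrangement in $V$ and $\mathcal{A}''=\mathcal{A}^{H_0}=\{H_0\cap H\mid H\in\mathcal{A}'\}$ is an arrangement in the vector space $H_0$ (as a set, without multiplicities). Partitions. Let $\pi=(\pi_1,\dots,\pi_s)$ be a partition of $\mathcal{A}$ into non-empty blocks; the numbering of the blocks is immaterial, and the block containing the chosen $H_0$ is labelled $\pi_1$. The partition of the empty arrangement is the empty one, with no non-empty blocks, written $(\varnothing)$. Given $H_0\in\pi_1$ and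 its triple: - the induced partition $\pi'$ of $\mathcal{A}'$ consists of the non-empty sets among $\pi_i\cap\mathcal{A}'$, $1\le i\le s$; - the restriction map is $\varrho=\varrho_{\pi,H_0}:\mathcal{A}\setminus\pi_1\to\mathcal{A}''$, $H\mapsto H\cap H_0$; - $\pi''=(\pi_2'',\dots,\pi_s'')$, where $\pi_i''=\varrho(\pi_i)=\{H\cap H_0\mid H\in\pi_i\}$ for $2\le i\le s$ (this is a partition of $\mathcal{A}''$ when $\varrho$ is bijective). Inductively factored arrangements. The class $\mathcal{IFAC}$ is the smallest class of pairs $(\mathcal{A},\pi)$, with $\mathcal{A}$ an arrangement and $\pi$ a partition of $\mathcal{A}$, such that: (i) $(\Phi_\ell,(\varnothing))\in\mathcal{IFAC}$ for each $\ell\ge 0$; (ii) if there exist a partition $\pi$ of $\mathcal{A}$ and a hyperplane $H_0\in\pi_1$ such that, for the triple $(\mathcal{A},\mathcal{A}',\mathcal{A}'')$ associated with $H_0$, the restriction map $\varrho_{\pi,H_0}:\mathcal{A}\setminus\pi_1\to\mathcal{A}''$ is bijective and both $(\mathcal{A}',\pi')$ and $(\mathcal{A}'',\pi'')$ belong to $\mathcal{IFAC}$, then $(\mathcal{A},\pi)$ belongs to $\mathcal{IFAC}$. An arrangement $\mathcal{A}$ is inductively factored if there is a partition $\pi$ of $\mathcal{A}$ with $(\mathcal{A},\pi)\in\mathcal{IFAC}$. *)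

theory Defs
  imports "HOL.Vector_Spaces" "HOL-Library.Disjoint_Sets"
begin

text \<open>
  The vector spaces that occur are the linear subspaces \<open>W\<close> of one fixed vector space, so that
  a hyperplane of an arrangement can itself serve as the ambient space of the restricted
  arrangement. Arrangements are sets of subspaces, and partitions are sets of blocks.
\<close>

definition localization :: "'a set set \<Rightarrow> 'a set \<Rightarrow> 'a set set" where
  "localization A U = {H \<in> A. U \<subseteq> H}"

definition restriction :: "'a set set \<Rightarrow> 'a set \<Rightarrow> 'a set set" where
  "restriction A H0 = {H0 \<inter> H | H. H \<in> A - {H0}}"

definition deletion_partition :: "'a set set \<Rightarrow> 'a set set set \<Rightarrow> 'a set \<Rightarrow> 'a set set set" where
  "deletion_partition A \<pi> H0 = {B \<inter> (A - {H0}) | B. B \<in> \<pi>} - {{}}"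

text \<open>
  \<open>P1\<close> is the block containing \<open>H0\<close>. Collecting the images of the other blocks in a set does not
  merge any of them when the restriction map is injective on \<open>A - P1\<close>, which is required wherever
  this is used.
\<close>

definition restriction_partition ::
    "'a set set set \<Rightarrow> 'a set set \<Rightarrow> 'a set \<Rightarrow> 'a set set set" where
  "restriction_partition \<pi> P1 H0 = {(\<lambda>H. H \<inter> H0) ` B | B. B \<in> \<pi> - {P1}}"

context vector_space
begin

definition hyperplane_in :: "'b set \<Rightarrow> 'b set \<Rightarrow> bool" where
  "hyperplane_in W H \<longleftrightarrow> subspace H \<and> H \<subseteq> W \<and> dim W = dim H + 1"

definition arrangement :: "'b set \<Rightarrow> 'b set set \<Rightarrow> bool" where
  "arrangement W A \<longleftrightarrow> subspace W \<and> finite A \<and> (\<forall>H\<in>A. hyperplane_in W H)"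

text \<open>
  \<open>IFAC W A \<pi>\<close>: the pair \<open>(A, \<pi>)\<close>, where \<open>A\<close> is an arrangement in \<open>W\<close>, is in the class.
\<close>

inductive IFAC :: "'b set \<Rightarrow> 'b set set \<Rightarrow> 'b set set set \<Rightarrow> bool" where
  empty: "subspace W \<Longrightarrow> IFAC W {} {}"
| step: "\<lbrakk>arrangement W A; partition_on A \<pi>; P1 \<in> \<pi>; H0 \<in> P1;
    bij_betw (\<lambda>H. H \<inter> H0) (A - P1) (restriction A H0);
    IFAC W (A - {H0}) (deletion_partition A \<pi> H0);
    IFAC H0 (restriction A H0) (restriction_partition \<pi> P1 H0)\<rbrakk>
    \<Longrightarrow> IFAC W A \<pi>"

definition inductively_factored :: "'b set \<Rightarrow> 'b set set \<Rightarrow> bool" where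
  "inductively_factored W A \<longleftrightarrow> (\<exists>\<pi>. IFAC W A \<pi>)"

lemma IFAC_arrangement: "IFAC W A \<pi> \<Longrightarrow> arrangement W A \<and> partition_on A \<pi>"
  by (induction rule: IFAC.induct) (auto simp: arrangement_def partition_on_def)

end

end

theory Submission imports Defs begin

text \<open>
  Localizing commutes with the two operations that define the class. Fix \<open>H0\<close> in the block \<open>P1\<close>,
  and let \<open>U\<close> be any subset of the ambient space.

  If \<open>H0\<close> does not contain \<open>U\<close>, then \<open>H0\<close> does not survive in the localization: the arrangement
  and the partition localize to the same pair as their deletions at \<open>H0\<close>, so induction along the
  deletion settles this case.

  If \<open>H0\<close> contains \<open>U\<close>, then \<open>U \<subseteq> H \<inter> H0\<close> is equivalent to \<open>U \<subseteq> H\<close>. Hence the deletion and the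
  restriction of the localization are the localizations of the deletion and of the restriction
  (lemmas \<open>localization_restriction\<close>, \<open>localization_deletion_partition\<close> and
  \<open>localization_restriction_partition\<close>), and the restriction map of the localization is
  the original one, restricted to the preimage of the localized restriction, so it remains
  bijective (\<open>bij_betw_localization\<close>). Both members of the triple are covered by the induction
  hypothesis, for the same \<open>U\<close>, and the defining step of the class applies again.

  The induction therefore has to carry the partition: a factored pair localizes to a factored pair
  whose blocks are the non-empty localized blocks.
\<close>

definition localization_partition :: "'a set set set \<Rightarrow> 'a set \<Rightarrow> 'a set set set" where
  "localization_partition \<pi> U = {localization B U | B. B \<in> \<pi>} - {{}}"

lemma localization_partition_image:
  "localization_partition \<pi> U = (\<lambda>B. localization B U) ` \<pi> - {{}}"
  by (auto simp: localization_partition_def)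

lemma deletion_partition_image:
  "deletion_partition A \<pi> H0 = (\<lambda>B. B \<inter> (A - {H0})) ` \<pi> - {{}}"
  by (auto simp: deletion_partition_def)

lemma restriction_partition_image:
  "restriction_partition \<pi> P1 H0 = (\<lambda>B. (\<lambda>H. H \<inter> H0) ` B) ` (\<pi> - {P1})"
  by (auto simp: restriction_partition_def)

text \<open>
  Empty blocks may be discarded at any stage as long as the maps applied afterwards send the empty
  block to itself.
\<close>

lemma image_discard_empty:
  assumes "f {} = {}"
  shows "f ` (X - {{}}) - {{}} = f ` X - {{}}"
  using assms by auto

lemma partition_on_localization:
  assumes "partition_on A \<pi>"
  shows "partition_on (localization A U) (localization_partition \<pi> U)"
proof -
  have "localization B U = localization A U \<inter> B" if "B \<in> \<pi>" for B
    using that partition_onD1[OF assms] by (auto simp: localization_def)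
  then have "localization_partition \<pi> U = (\<inter>) (localization A U) ` \<pi> - {{}}"
    by (simp add: localization_partition_image cong: image_cong)
  then show ?thesis
    using partition_on_restrict[OF assms, of "localization A U"]
    by (simp add: localization_def Int_absorb2)
qed

lemma localization_delete_not_above:
  assumes "\<not> U \<subseteq> H0"
  shows "localization (A - {H0}) U = localization A U"
  using assms by (auto simp: localization_def)

lemma localization_partition_delete_not_above:
  assumes "partition_on A \<pi>" and "\<not> U \<subseteq> H0"
  shows "localization_partition (deletion_partition A \<pi> H0) U = localization_partition \<pi> U"
proof -
  have loc: "localization (B \<inter> (A - {H0})) U = localization B U" if "B \<in> \<pi>" for B
    using that assms partition_onD1[OF assms(1)] by (auto simp: localization_def)
  have "localization_partition (deletion_partition A \<pi> H0) U
      = (\<lambda>B. localization B U) ` (\<lambda>B. B \<inter> (A - {H0})) ` \<pi> - {{}}"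
    unfolding localization_partition_image deletion_partition_image
    by (rule image_discard_empty) (simp add: localization_def)
  then show ?thesis
    by (simp add: localization_partition_image image_image loc cong: image_cong)
qed

lemma localization_deletion_partition:
  assumes "partition_on A \<pi>"
  shows "localization_partition (deletion_partition A \<pi> H0) U =
    deletion_partition (localization A U) (localization_partition \<pi> U) H0"
proof -
  have loc: "localization (B \<inter> (A - {H0})) U = localization B U \<inter> (localization A U - {H0})" for B
    by (auto simp: localization_def)
  have "localization_partition (deletion_partition A \<pi> H0) U
      = (\<lambda>B. localization B U) ` (\<lambda>B. B \<inter> (A - {H0})) ` \<pi> - {{}}"
    unfolding localization_partition_image deletion_partition_image
    by (rule image_discard_empty) (simp add: localization_def)
  also have "\<dots> = (\<lambda>C. C \<inter> (localization A U - {H0})) ` (\<lambda>B. localization B U) ` \<pi> - {{}}"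
    by (simp add: image_image loc)
  also have "\<dots> = deletion_partition (localization A U) (localization_partition \<pi> U) H0"
    unfolding localization_partition_image deletion_partition_image
    by (rule image_discard_empty[symmetric]) simp
  finally show ?thesis .
qed

lemma localization_restriction:
  assumes "U \<subseteq> H0"
  shows "localization (restriction A H0) U = restriction (localization A U) H0"
  using assms by (auto simp: localization_def restriction_def)

lemma localization_image_Int:
  assumes "U \<subseteq> H0"
  shows "localization ((\<lambda>H. H \<inter> H0) ` B) U = (\<lambda>H. H \<inter> H0) ` localization B U"
  using assms by (auto simp: localization_def)

text \<open>
  The block \<open>P1\<close> can be removed before or after localizing: its localization contains \<open>H0\<close>, and
  distinct blocks are disjoint, so no other block localizes to the same set.
\<close>

lemma localization_restriction_partition:
  assumes "partition_on A \<pi>" and "P1 \<in> \<pi>" and "H0 \<in> P1" and "U \<subseteq> H0"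
  shows "localization_partition (restriction_partition \<pi> P1 H0) U =
    restriction_partition (localization_partition \<pi> U) (localization P1 U) H0"
proof -
  have eq: "B = P1" if "B \<in> \<pi>" "localization B U = localization P1 U" for B
  proof -
    have "H0 \<in> B"
      using that(2) assms(3,4) by (auto simp: localization_def)
    then show ?thesis
      using partition_onD2[OF assms(1)] that(1) assms(2,3) by (auto dest: disjointD)
  qed
  then have blocks: "localization_partition \<pi> U - {localization P1 U}
      = (\<lambda>B. localization B U) ` (\<pi> - {P1}) - {{}}"
    unfolding localization_partition_image by blast
  have "localization_partition (restriction_partition \<pi> P1 H0) U
      = (\<lambda>C. (\<lambda>H. H \<inter> H0) ` C) ` (\<lambda>B. localization B U) ` (\<pi> - {P1}) - {{}}"
    by (simp add: localization_partition_image restriction_partition_image image_image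
        localization_image_Int[OF assms(4)])
  also have "\<dots> = (\<lambda>C. (\<lambda>H. H \<inter> H0) ` C) ` ((\<lambda>B. localization B U) ` (\<pi> - {P1}) - {{}})"
    by blast
  finally show ?thesis
    by (simp add: restriction_partition_image blocks)
qed

text \<open>
  Surjectivity: if \<open>H\<close> contains \<open>U\<close>, any \<open>K\<close> with \<open>K \<inter> H0 = H \<inter> H0\<close> also contains \<open>U\<close>, so the
  preimage of a localized hyperplane outside \<open>P1\<close> is itself in the localization.
\<close>

lemma bij_betw_localization:
  assumes "bij_betw (\<lambda>H. H \<inter> H0) (A - P1) (restriction A H0)" and "U \<subseteq> H0"
  shows "bij_betw (\<lambda>H. H \<inter> H0) (localization A U - localization P1 U)
    (restriction (localization A U) H0)"
proof -
  have diff: "localization A U - localization P1 U = localization (A - P1) U"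
    by (auto simp: localization_def)
  have "(\<lambda>H. H \<inter> H0) ` localization (A - P1) U = localization (restriction A H0) U"
    using localization_image_Int[OF assms(2), of "A - P1"] bij_betw_imp_surj_on[OF assms(1)]
    by simp
  moreover have "inj_on (\<lambda>H. H \<inter> H0) (localization (A - P1) U)"
    using bij_betw_imp_inj_on[OF assms(1)]
    by (rule inj_on_subset) (auto simp: localization_def)
  ultimately show ?thesis
    using assms(2) by (simp add: bij_betw_def diff localization_restriction)
qed

context vector_space
begin

lemma arrangement_localization: "arrangement W A \<Longrightarrow> arrangement W (localization A U)"
  by (auto simp: arrangement_def localization_def)

lemma IFAC_localization:
  assumes "IFAC W A \<pi>"
  shows "IFAC W (localization A U) (localization_partition \<pi> U)"
  using assms
proof (induction rule: IFAC.induct)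
  case (empty W)
  then show ?case
    using IFAC.empty by (simp add: localization_def localization_partition_def)
next
  case (step W A \<pi> P1 H0)
  show ?case
  proof (cases "U \<subseteq> H0")
    case False
    then show ?thesis
      using step.IH(1) step.hyps(2)
      by (simp add: localization_delete_not_above localization_partition_delete_not_above)
  next
    case True
    have "H0 \<in> localization P1 U"
      using True step.hyps(4) by (simp add: localization_def)
    moreover from this have "localization P1 U \<in> localization_partition \<pi> U"
      using step.hyps(3) by (auto simp: localization_partition_def)
    moreover have "localization (A - {H0}) U = localization A U - {H0}"
      by (auto simp: localization_def)
    ultimately show ?thesis
      using IFAC.step[OF arrangement_localization[OF step.hyps(1)]
          partition_on_localization[OF step.hyps(2)] _ _ bij_betw_localization[OF step.hyps(5) True]]
        step.IH step.hyps True
      by (simp add: localization_restriction localization_deletion_partition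
          localization_restriction_partition)
  qed
qed

end

theorem theorem1p1:
  fixes scale :: "'k::field \<Rightarrow> 'v::ab_group_add \<Rightarrow> 'v"
    and B :: "'v set"
    and A :: "'v set set"
    and U :: "'v set"
  assumes "finite_dimensional_vector_space scale B"
    and "vector_space.arrangement scale UNIV A"
    and "vector_space.inductively_factored scale UNIV A"
    and "module.subspace scale U"
  shows "vector_space.inductively_factored scale UNIV (localization A U)"
proof -
  interpret finite_dimensional_vector_space scale B
    by (fact assms(1))
  show ?thesis
    using assms(3) IFAC_localization unfolding inductively_factored_def by blast
qed

end
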